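(* Let $p$ be a prime and $\frac{a}{p}$ an irreducible fraction. If $\mathcal{S}_{\frac{a}{p}}(q)$ is reducible in $\mathbb Q[q]$, then every irreducible factor of $\mathcal{S}_{\frac{a}{p}}(q)$ in $\mathbb Q[q]$ has degree at least $7$.
   Context: For an integer $c$, $[c]_q=\frac{1-q^c}{1-q}$. Every rational $\alpha>1$ has a unique negative continued fraction expansion $\alpha=c_1-\cfrac{1}{c_2-\cfrac{1}{\ddots-\cfrac{1}{c_l}}}$ with integers $c_j\ge 2$. Put $M^-_q(c)=\begin{pmatrix}[c]_q & -q^{c-1}\\ 1 & 0\end{pmatrix}$ and define $\mathcal{R}_\alpha(q),\mathcal{S}_\alpha(q)$ by $\begin{pmatrix}\mathcal{R}_\alpha(q)\\ \mathcal{S}_\alpha(q)\end{pmatrix}=M^-_q(c_1)\cdots M^-_q(c_l)\begin{pmatrix}1\\0\end{pmatrix}$. For rational $\alpha\le 1$ they are defined recursively by $\mathcal{S}_\alpha(q)=\mathcal{S}_{\alpha+1}(q)$ and $\mathcal{R}_\alpha(q)=q^{-1}(\mathcal{R}_{\alpha+1}(q)-\mathcal{S}_{\alpha+1}(q))$. $\mathcal{S}_\alpha(q)\in\mathbb Z[q]$. *)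

theory Defs
  imports
    "HOL-Analysis.Cartesian_Space"
    "HOL-Computational_Algebra.Polynomial_Factorial"
begin

text \<open>Polynomials in \<open>q\<close>; the indeterminate is \<open>monom 1 1\<close>.
  The division below is exact, see \<open>q_int_mult\<close>.\<close>

definition q_int :: "nat \<Rightarrow> int poly" where
  "q_int c = (1 - monom 1 c) div (1 - monom 1 1)"

lemma q_int_eq_sum_aux: "(1 - monom 1 1) * (\<Sum>i<c. monom (1::int) i) = 1 - monom 1 c"
proof (induction c)
  case (Suc c)
  have "(1 - monom 1 1) * (\<Sum>i<Suc c. monom (1::int) i)
      = (1 - monom 1 c) + (1 - monom 1 1) * monom 1 c"
    unfolding Suc.IH[symmetric] by (simp add: distrib_left)
  then show ?case by (simp add: left_diff_distrib mult_monom)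
qed simp

lemma q_int_eq_sum: "q_int c = (\<Sum>i<c. monom 1 i)"
proof -
  have "coeff (1 - monom 1 1 :: int poly) 0 \<noteq> coeff 0 0"
    by simp
  then have nz: "(1 - monom 1 1 :: int poly) \<noteq> 0"
    by metis
  show ?thesis
    unfolding q_int_def q_int_eq_sum_aux[of c, symmetric]
    using nz by (rule nonzero_mult_div_cancel_left)
qed

lemma q_int_mult: "(1 - monom 1 1) * q_int c = 1 - monom 1 c"
  unfolding q_int_eq_sum by (rule q_int_eq_sum_aux)

fun neg_cf :: "nat list \<Rightarrow> rat" where
  "neg_cf [] = 0"
| "neg_cf [c] = of_nat c"
| "neg_cf (c # d # cs) = of_nat c - 1 / neg_cf (d # cs)"

definition is_neg_cf_expansion :: "rat \<Rightarrow> nat list \<Rightarrow> bool" where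
  "is_neg_cf_expansion \<alpha> cs \<longleftrightarrow> cs \<noteq> [] \<and> (\<forall>c \<in> set cs. 2 \<le> c) \<and> neg_cf cs = \<alpha>"

definition neg_cf_expansion :: "rat \<Rightarrow> nat list" where
  "neg_cf_expansion \<alpha> = (THE cs. is_neg_cf_expansion \<alpha> cs)"

lemma neg_cf_gt_1: "cs \<noteq> [] \<Longrightarrow> \<forall>c \<in> set cs. 2 \<le> c \<Longrightarrow> 1 < neg_cf cs"
proof (induction cs rule: neg_cf.induct)
  case (3 c d cs)
  then have "1 < neg_cf (d # cs)" by simp
  then have "1 / neg_cf (d # cs) < 1" by simp
  moreover have "(2::rat) \<le> of_nat c" using 3 by simp
  ultimately show ?case by simp
qed auto

lemma neg_cf_ceiling:
  assumes "\<forall>c \<in> set (c # cs). 2 \<le> c"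
  shows "\<lceil>neg_cf (c # cs)\<rceil> = int c"
proof (cases cs)
  case (Cons d ds)
  then have "1 < neg_cf cs" using assms by (intro neg_cf_gt_1) auto
  then have "0 < 1 / neg_cf cs" "1 / neg_cf cs < 1" by simp_all
  then show ?thesis using Cons by (intro ceiling_unique) simp_all
qed simp

lemma is_neg_cf_expansion_unique:
  "is_neg_cf_expansion \<alpha> cs \<Longrightarrow> is_neg_cf_expansion \<alpha> ds \<Longrightarrow> cs = ds"
proof (induction cs arbitrary: \<alpha> ds)
  case Nil
  then show ?case by (simp add: is_neg_cf_expansion_def)
next
  case (Cons c cs)
  obtain d ds' where ds: "ds = d # ds'"
    using Cons.prems by (cases ds) (auto simp: is_neg_cf_expansion_def)
  have all: "\<forall>x \<in> set (c # cs). 2 \<le> x" "\<forall>x \<in> set (d # ds'). 2 \<le> x"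
    and eq: "neg_cf (c # cs) = neg_cf (d # ds')"
    using Cons.prems ds by (auto simp: is_neg_cf_expansion_def)
  have cd: "c = d"
    using neg_cf_ceiling[OF all(1)] neg_cf_ceiling[OF all(2)] eq by simp
  have gt: "cs \<noteq> [] \<Longrightarrow> 1 < neg_cf cs" "ds' \<noteq> [] \<Longrightarrow> 1 < neg_cf ds'"
    using all by (auto intro!: neg_cf_gt_1)
  have "cs = ds'"
  proof (cases "cs = [] \<or> ds' = []")
    case True
    then show ?thesis using eq cd gt by (cases cs; cases ds') auto
  next
    case False
    then have "1 / neg_cf cs = 1 / neg_cf ds'"
      using eq cd by (cases cs; cases ds') auto
    then have "neg_cf cs = neg_cf ds'" by simp
    then show ?thesis
      using Cons.IH[of "neg_cf cs" ds'] False all by (auto simp: is_neg_cf_expansion_def)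
  qed
  then show ?case using cd ds by simp
qed

lemma is_neg_cf_expansion_exists:
  fixes m n :: nat
  assumes "0 < n" "n < m"
  shows "\<exists>cs. is_neg_cf_expansion (of_nat m / of_nat n) cs"
  using assms
proof (induction n arbitrary: m rule: less_induct)
  case (less n)
  define r where "r = m mod n"
  define k where "k = m div n"
  have m: "m = k * n + r" by (simp add: r_def k_def)
  have k: "1 \<le> k" using less.prems by (simp add: k_def div_greater_zero_iff Suc_le_eq)
  show ?case
  proof (cases "r = 0")
    case True
    then have "2 \<le> k" using less.prems m k by (cases "k = 1") auto
    then have "is_neg_cf_expansion (of_nat m / of_nat n) [k]"
      using True m less.prems by (simp add: is_neg_cf_expansion_def)
    then show ?thesis by blast
  next
    case False
    have r: "0 < r" "r < n" using False less.prems by (simp_all add: r_def)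
    then obtain cs where cs: "is_neg_cf_expansion (of_nat n / of_nat (n - r)) cs"
      using less.IH[of "n - r" n] less.prems by auto
    then obtain d ds where dds: "cs = d # ds"
      by (cases cs) (auto simp: is_neg_cf_expansion_def)
    have "neg_cf ((k + 1) # cs) = of_nat (k + 1) - of_nat (n - r) / of_nat n"
      using cs dds by (simp add: is_neg_cf_expansion_def)
    also have "\<dots> = of_nat m / (of_nat n :: rat)"
      using r less.prems by (simp add: m of_nat_diff field_simps)
    finally have "is_neg_cf_expansion (of_nat m / of_nat n) ((k + 1) # cs)"
      using cs k by (auto simp: is_neg_cf_expansion_def)
    then show ?thesis by blast
  qed
qed

lemma ex1_neg_cf_expansion:
  assumes "1 < \<alpha>"
  shows "\<exists>!cs. is_neg_cf_expansion \<alpha> cs"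
proof -
  obtain a b :: int where ab: "\<alpha> = of_int a / of_int b" "0 < b"
    by (metis Fract_of_int_quotient Rat_cases)
  have "(of_int b :: rat) < of_int a" using assms ab by (simp add: field_simps)
  then have "b < a" by simp
  then have "0 < nat b" "nat b < nat a" "\<alpha> = of_nat (nat a) / of_nat (nat b)"
    using ab by simp_all
  then show ?thesis
    using is_neg_cf_expansion_exists is_neg_cf_expansion_unique by metis
qed

lemma neg_cf_expansion: "1 < \<alpha> \<Longrightarrow> is_neg_cf_expansion \<alpha> (neg_cf_expansion \<alpha>)"
  unfolding neg_cf_expansion_def by (rule theI') (rule ex1_neg_cf_expansion)

definition M_q :: "nat \<Rightarrow> int poly ^ 2 ^ 2" where
  "M_q c = vector [vector [q_int c, - monom 1 (c - 1)],
                   vector [1,       0]]"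

definition RS_cf :: "nat list \<Rightarrow> int poly ^ 2" where
  "RS_cf cs = foldr (\<lambda>c A. M_q c ** A) cs (mat 1) *v vector [1, 0]"

text \<open>The denominator \<open>\<S>\<^sub>\<alpha>(q)\<close> of the \<open>q\<close>-rational.  The recursion extending \<open>(\<R>\<^sub>\<alpha>, \<S>\<^sub>\<alpha>)\<close> to
  \<open>\<alpha> \<le> 1\<close> does not use \<open>\<R>\<close> (which need not be a polynomial) in its second component, so
  \<open>\<S>\<close> is defined on its own.\<close>

function q_denom :: "rat \<Rightarrow> int poly" where
  "q_denom \<alpha> = (if 1 < \<alpha> then RS_cf (neg_cf_expansion \<alpha>) $ 2 else q_denom (\<alpha> + 1))"
  by auto
termination
proof (relation "measure (\<lambda>\<alpha>. nat (2 - \<lfloor>\<alpha>\<rfloor>))")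
  fix \<alpha> :: rat
  assume "\<not> 1 < \<alpha>"
  then have "\<lfloor>\<alpha>\<rfloor> \<le> 1" by linarith
  then show "(\<alpha> + 1, \<alpha>) \<in> measure (\<lambda>\<alpha>. nat (2 - \<lfloor>\<alpha>\<rfloor>))" by simp
qed simp

declare q_denom.simps [simp del]

definition reducible :: "'a::comm_semiring_1 \<Rightarrow> bool" where
  "reducible f \<longleftrightarrow> f \<noteq> 0 \<and> (\<exists>g h. f = g * h \<and> \<not> g dvd 1 \<and> \<not> h dvd 1)"

end

theory Submission
  imports Defs
begin

text \<open>On the unit circle the matrices \<open>M\<^sub>q(c)\<close> preserve a Hermitian form.  It is definite at
  \<open>q = - 1\<close>, \<open>q = \<i>\<close> and \<open>q = \<omega>\<close> (a primitive cube root of unity) and bounds \<open>|\<S>(q)|\<close> there.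
  Together with the congruence between \<open>|\<S>(q)|\<^sup>2\<close> and \<open>\<S>(1)\<^sup>2 = p\<^sup>2\<close> this gives \<open>|\<S>(q)| = 1\<close> if
  \<open>p > 3\<close>.  Hence \<open>|f(q)| = 1\<close> for every factor \<open>f\<close> of \<open>\<S>\<close>, which by Gauss's lemma and the
  positivity of \<open>\<S>\<close> on the nonnegative reals may be taken monic and integral with \<open>f(0) = 1\<close>.
  In degree at most 6 these conditions leave finitely many \<open>f\<close>, and all of them satisfy
  \<open>f(1) > 1\<close>.  In a factorization \<open>\<S> = f h\<close> with \<open>deg f \<le> 6\<close> we thus have \<open>f(1) = p\<close> and
  \<open>h(1) = 1\<close>, so \<open>deg h \<ge> 7\<close> and \<open>\<S>(2) \<ge> 2 ^ deg \<S> \<ge> 2 ^ (deg f + 7)\<close>.  This leaves finitely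
  many \<open>p\<close>, and for each of them \<open>f(2)\<close> does not divide a value \<open>\<S>(2)\<close> of that size.\<close>

section \<open>Integer polynomials\<close>

lemma map_poly_of_int_add:
  "map_poly of_int (f + g) = (map_poly of_int f + map_poly of_int g :: 'a::comm_ring_1 poly)"
  by (rule poly_eqI) (simp add: coeff_map_poly)

lemma map_poly_of_int_mult:
  "map_poly of_int (f * g) = (map_poly of_int f * map_poly of_int g :: 'a::comm_ring_1 poly)"
  by (rule poly_eqI) (simp add: coeff_map_poly coeff_mult)

lemma lead_coeff_map_poly_of_int:
  "lead_coeff (map_poly of_int f :: 'a::{comm_ring_1,ring_char_0} poly) = of_int (lead_coeff f)"
  by (simp add: degree_map_poly coeff_map_poly)

definition ipoly :: "int poly \<Rightarrow> 'a::comm_ring_1 \<Rightarrow> 'a" where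
  "ipoly f z = poly (map_poly of_int f) z"

lemma ipoly_0 [simp]: "ipoly 0 z = 0"
  and ipoly_1 [simp]: "ipoly 1 z = 1"
  and ipoly_pCons [simp]: "ipoly (pCons a f) z = of_int a + z * ipoly f z"
  and ipoly_monom [simp]: "ipoly (monom 1 n) z = z ^ n"
  by (simp_all add: ipoly_def map_poly_pCons map_poly_monom poly_monom)

lemma ipoly_add [simp]: "ipoly (f + g) z = ipoly f z + ipoly g z"
  and ipoly_mult [simp]: "ipoly (f * g) z = ipoly f z * ipoly g z"
  by (simp_all add: ipoly_def map_poly_of_int_add map_poly_of_int_mult)

lemma ipoly_diff [simp]: "ipoly (f - g) z = ipoly f z - ipoly g z"
  using ipoly_add[of "f - g" g z] by (simp add: algebra_simps del: ipoly_add)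

lemma ipoly_of_int: "ipoly f (of_int x) = of_int (poly f x)"
  by (induction f) simp_all

lemma poly_pos_if_monic_no_nonneg_root:
  fixes f :: "int poly"
  assumes lc: "lead_coeff f = 1" and nz: "\<And>x::real. 0 \<le> x \<Longrightarrow> ipoly f x \<noteq> 0" and "0 \<le> n"
  shows "0 < poly f n"
proof (rule ccontr)
  define F where "F = map_poly real_of_int f"
  have F: "poly F x = ipoly f x" for x by (simp add: F_def ipoly_def)
  assume "\<not> 0 < poly f n"
  with nz[of "of_int n"] \<open>0 \<le> n\<close> have neg: "poly F (of_int n) < 0"
    by (simp add: F ipoly_of_int)
  have "lead_coeff F = 1"
    unfolding F_def lead_coeff_map_poly_of_int using lc by simp
  then obtain b where F_ge_1: "\<forall>x \<ge> b. poly F x \<ge> 1" using poly_pinfty_gt_lc[of F] by auto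
  define c where "c = max b (of_int n + 1)"
  have "poly F c > 0" using F_ge_1[rule_format, of c] by (simp add: c_def)
  moreover have "of_int n < c" by (simp add: c_def)
  ultimately obtain x where "of_int n < x" "poly F x = 0"
    using poly_IVT_pos[of "of_int n" c F] neg by blast
  then show False using nz[of x] \<open>0 \<le> n\<close> by (simp add: F)
qed

section \<open>Factorizations over the rationals\<close>

lemma ex_clear_denominators:
  fixes g :: "rat poly"
  shows "\<exists>a G. a \<noteq> 0 \<and> map_poly rat_of_int G = smult (of_int a) g"
proof (induction g)
  case 0
  show ?case by (intro exI[of _ 1] exI[of _ 0]) simp
next
  case (pCons x g)
  then obtain a G where a: "a \<noteq> 0" "map_poly rat_of_int G = smult (of_int a) g" by blast
  obtain m n :: int where mn: "x = of_int m / of_int n" "n \<noteq> 0"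
    by (metis Fract_of_int_quotient Rat_cases less_irrefl)
  have "map_poly rat_of_int (pCons (a * m) (smult n G)) = smult (of_int (a * n)) (pCons x g)"
    using mn by (simp add: map_poly_pCons map_poly_smult a(2) mult.commute)
  then show ?case using a mn by (metis mult_eq_0_iff)
qed

lemma ex_primitive_int_poly:
  fixes g :: "rat poly"
  assumes "g \<noteq> 0"
  shows "\<exists>a G. g = smult a (map_poly rat_of_int G) \<and> content G = 1"
proof -
  obtain a G where G: "a \<noteq> 0" "map_poly rat_of_int G = smult (of_int a) g"
    using ex_clear_denominators by blast
  then have "G \<noteq> 0" using assms by auto
  have "g = smult (1 / of_int a) (map_poly rat_of_int G)" using G by simp
  also have "map_poly rat_of_int G
      = smult (of_int (content G)) (map_poly rat_of_int (primitive_part G))"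
    by (simp flip: map_poly_smult)
  finally have "g = smult (of_int (content G) / of_int a) (map_poly rat_of_int (primitive_part G))"
    by simp
  then show ?thesis using \<open>G \<noteq> 0\<close> content_primitive_part by blast
qed

lemma monic_gauss_factorization:
  fixes F :: "int poly" and g h :: "rat poly"
  assumes lc: "lead_coeff F = 1" and F: "map_poly rat_of_int F = g * h"
  shows "\<exists>G H. F = G * H \<and> degree G = degree g \<and> degree H = degree h \<and>
    lead_coeff G = 1 \<and> lead_coeff H = 1"
proof -
  have "F \<noteq> 0" using lc by auto
  then have "g \<noteq> 0" "h \<noteq> 0" using F by (auto simp: map_poly_eq_0_iff)
  then obtain a G b H where G: "g = smult a (map_poly rat_of_int G)" "content G = 1"
    and H: "h = smult b (map_poly rat_of_int H)" "content H = 1"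
    using ex_primitive_int_poly by metis
  define k l where "k = lead_coeff G" and "l = lead_coeff H"
  have FGH: "map_poly rat_of_int F = smult (a * b) (map_poly rat_of_int (G * H))"
    using F by (simp add: G H map_poly_of_int_mult mult.commute)
  have "a * b * of_int (k * l) = 1"
    using arg_cong[OF FGH, of lead_coeff] lc
    unfolding lead_coeff_smult lead_coeff_map_poly_of_int lead_coeff_mult by (simp add: k_def l_def)
  then have "map_poly rat_of_int (smult (k * l) F) = map_poly rat_of_int (G * H)"
    by (simp add: map_poly_smult FGH mult.commute)
  then have GH: "smult (k * l) F = G * H"
    by (simp add: poly_eq_iff coeff_map_poly flip: of_int_mult)
  have "is_unit (content F)" using content_dvd_coeff[of F "degree F"] lc by simp
  then have "content F = 1" by (metis is_unit_normalize normalize_content)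
  then have "\<bar>k * l\<bar> = 1"
    using arg_cong[OF GH, of content] G(2) H(2) by (simp add: content_mult)
  then have kl: "\<bar>k\<bar> = 1" "\<bar>l\<bar> = 1" by (auto simp: abs_mult zmult_eq_1_iff)
  then have squares: "k * k = 1" "l * l = 1" by (auto simp: abs_if split: if_splits)
  have "smult k G * smult l H = smult (k * l) (smult (k * l) F)" by (simp add: GH mult.commute)
  moreover have "k * l * (k * l) = 1" using squares by (metis mult.assoc mult.commute mult_1)
  ultimately have "F = smult k G * smult l H" by (simp only: smult_smult smult_1_left)
  moreover have "degree (smult k G) = degree g" "degree (smult l H) = degree h"
    using kl \<open>g \<noteq> 0\<close> \<open>h \<noteq> 0\<close> by (auto simp: G H degree_map_poly)
  moreover have "lead_coeff (smult k G) = 1" "lead_coeff (smult l H) = 1"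
    using squares kl by (auto simp: k_def l_def)
  ultimately show ?thesis by blast
qed

lemma reducible_cofactorE:
  fixes f :: "'a::algebraic_semidom"
  assumes "reducible f" "irreducible g" "g dvd f"
  obtains h where "f = g * h" "h \<noteq> 0" "\<not> is_unit h"
proof -
  obtain h where h: "f = g * h" using assms(3) by blast
  moreover have "h \<noteq> 0" using assms(1) h by (auto simp: reducible_def)
  moreover have "\<not> is_unit h"
  proof
    assume "is_unit h"
    then have "irreducible f" using assms(2) h by (metis irreducible_mult_unit_left mult.commute)
    then show False using assms(1) by (auto simp: reducible_def dest: irreducibleD)
  qed
  ultimately show thesis using that by blast
qed

section \<open>The recursion for \<open>\<R>\<close> and \<open>\<S>\<close>\<close>

abbreviation R_cf :: "nat list \<Rightarrow> int poly" where
  "R_cf cs \<equiv> RS_cf cs $ 1"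

abbreviation S_cf :: "nat list \<Rightarrow> int poly" where
  "S_cf cs \<equiv> RS_cf cs $ 2"

lemma RS_cf_Nil [simp]: "R_cf [] = 1" "S_cf [] = 0"
  by (simp_all add: RS_cf_def)

lemma RS_cf_Cons [simp]:
  "R_cf (c # cs) = q_int c * R_cf cs - monom 1 (c - 1) * S_cf cs"
  "S_cf (c # cs) = R_cf cs"
proof -
  have "RS_cf (c # cs) = M_q c *v RS_cf cs"
    by (simp add: RS_cf_def matrix_vector_mul_assoc)
  then show "R_cf (c # cs) = q_int c * R_cf cs - monom 1 (c - 1) * S_cf cs"
    "S_cf (c # cs) = R_cf cs"
    by (simp_all add: matrix_vector_mult_def sum_2 M_q_def)
qed

function neg_cf_digits :: "nat \<Rightarrow> nat \<Rightarrow> nat list" where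
  "neg_cf_digits m n = (if n = 0 then [] else
     let c = (m + n - 1) div n in c # neg_cf_digits n (c * n - m))"
  by auto
termination
proof (relation "measure snd")
  fix m n c :: nat
  assume "n \<noteq> 0" "c = (m + n - 1) div n"
  moreover from this have "c * n \<le> m + n - 1" by simp
  ultimately have "c * n - m < n" by linarith
  then show "((n, c * n - m), (m, n)) \<in> measure snd" by simp
qed simp

declare neg_cf_digits.simps [simp del]

lemma neg_cf_digits_0 [simp]: "neg_cf_digits m 0 = []"
  by (simp add: neg_cf_digits.simps)

lemma neg_cf_digits_ConsE:
  assumes "0 < n"
  obtains c r where "neg_cf_digits m n = c # neg_cf_digits n r" "c * n = m + r" "r < n"
proof -
  define c where "c = (m + n - 1) div n"
  have "(m + n - 1) mod n + c * n = m + n - 1" "(m + n - 1) mod n < n"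
    using assms by (simp_all add: c_def mult.commute)
  then have "c * n = m + (c * n - m)" "c * n - m < n" using assms by linarith+
  moreover have "neg_cf_digits m n = c # neg_cf_digits n (c * n - m)"
    using assms by (subst neg_cf_digits.simps) (simp add: c_def Let_def)
  ultimately show thesis using that by blast
qed

lemma neg_cf_digits_ge_2: "n < m \<Longrightarrow> \<forall>c \<in> set (neg_cf_digits m n). 2 \<le> c"
proof (induction n arbitrary: m rule: less_induct)
  case (less n)
  show ?case
  proof (cases "n = 0")
    case False
    then obtain c r where digits: "neg_cf_digits m n = c # neg_cf_digits n r"
      and r: "c * n = m + r" "r < n"
      using neg_cf_digits_ConsE[of n m] by blast
    have "1 * n < c * n" using less.prems r by simp
    then have "2 \<le> c" by (metis Suc_leI mult_less_cancel2 Suc_1)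
    with less.IH[OF r(2) r(2)] show ?thesis by (simp add: digits)
  qed simp
qed

lemma neg_cf_neg_cf_digits:
  "0 < n \<Longrightarrow> n < m \<Longrightarrow> neg_cf (neg_cf_digits m n) = of_nat m / of_nat n"
proof (induction n arbitrary: m rule: less_induct)
  case (less n)
  obtain c r where digits: "neg_cf_digits m n = c # neg_cf_digits n r"
    and r: "c * n = m + r" "r < n"
    using neg_cf_digits_ConsE[OF less.prems(1), of m] by blast
  have m: "(of_nat m :: rat) = of_nat c * of_nat n - of_nat r"
    using arg_cong[OF r(1), of "of_nat :: nat \<Rightarrow> rat"] by simp
  show ?case
  proof (cases "r = 0")
    case True
    then show ?thesis using less.prems by (simp add: digits m)
  next
    case False
    then have "neg_cf (neg_cf_digits n r) = of_nat n / of_nat r"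
      using less.IH r(2) by simp
    moreover have "neg_cf_digits n r \<noteq> []"
      using False neg_cf_digits_ConsE[of r n] by (metis list.distinct(1) neq0_conv)
    then have "neg_cf (c # neg_cf_digits n r) = of_nat c - 1 / neg_cf (neg_cf_digits n r)"
      by (metis neg_cf.simps(3) neq_Nil_conv)
    ultimately show ?thesis using less.prems by (simp add: digits m field_simps)
  qed
qed

lemma neg_cf_expansion_eq_neg_cf_digits:
  assumes "0 < n" "n < m"
  shows "neg_cf_expansion (of_nat m / of_nat n) = neg_cf_digits m n"
proof -
  have "neg_cf_digits m n \<noteq> []"
    using assms neg_cf_digits_ConsE[of n m] by (metis list.distinct(1))
  then have "is_neg_cf_expansion (of_nat m / of_nat n) (neg_cf_digits m n)"
    using assms
    by (simp add: is_neg_cf_expansion_def neg_cf_digits_ge_2 neg_cf_neg_cf_digits)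
  moreover have "is_neg_cf_expansion (of_nat m / of_nat n) (neg_cf_expansion (of_nat m / of_nat n))"
    using assms by (intro neg_cf_expansion) simp
  ultimately show ?thesis by (rule is_neg_cf_expansion_unique[symmetric])
qed

lemma q_denom_eq_R_cf:
  assumes "0 < n"
  shows "q_denom (of_int a / of_nat n) = R_cf (neg_cf_digits n (nat (- a mod int n)))"
    (is "q_denom ?\<alpha> = _")
  using assms
proof (induction ?\<alpha> arbitrary: a rule: q_denom.induct)
  case IH: 1
  show ?case
  proof (cases "1 < (of_int a / of_nat n :: rat)")
    case True
    define m where "m = nat a"
    have "int n < a" using True assms by (simp add: field_simps)
    then have a: "a = int m" and "n < m" by (simp_all add: m_def)
    obtain c r where digits: "neg_cf_digits m n = c # neg_cf_digits n r"
      and r: "c * n = m + r" "r < n"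
      using neg_cf_digits_ConsE[OF assms, of m] by blast
    have "- a = int r + - int c * int n"
      using arg_cong[OF r(1), of int] by (simp add: a)
    then have "nat (- a mod int n) = r" using r(2) by (simp del: mult_minus_left)
    then show ?thesis
      using True neg_cf_expansion_eq_neg_cf_digits[OF assms \<open>n < m\<close>]
      by (simp add: q_denom.simps[of "of_nat m / of_nat n"] a digits)
  next
    case False
    have "(of_int a / of_nat n :: rat) + 1 = of_int (a + int n) / of_nat n"
      using assms by (simp add: field_simps)
    moreover have "- (a + int n) mod int n = - a mod int n"
      by (simp add: mod_diff_right_eq[symmetric])
    ultimately show ?thesis
      using IH(1)[of "a + int n"] False assms
      by (simp add: q_denom.simps[of "of_int a / of_nat n"])
  qed
qed

lemma q_denom_eq_R_cf_coprime:
  assumes "0 < n" "coprime a (int n)"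
  obtains r where "r < n" "coprime n r" "q_denom (of_int a / of_nat n) = R_cf (neg_cf_digits n r)"
proof -
  define r where "r = nat (- a mod int n)"
  have r: "int r = - a mod int n" using assms(1) by (simp add: r_def)
  have "int r < int n" unfolding r using assms(1) by simp
  then have "r < n" by simp
  moreover have "coprime n r" using assms by (simp add: r coprime_commute flip: coprime_int_iff)
  ultimately show thesis using that q_denom_eq_R_cf[OF assms(1), of a] unfolding r_def by blast
qed

lemma poly_q_int: "poly (q_int c) x = (\<Sum>i<c. x ^ i)"
  by (simp add: q_int_eq_sum poly_sum poly_monom)

lemma poly_RS_cf_neg_cf_digits_1:
  assumes "coprime m n"
  shows "poly (R_cf (neg_cf_digits m n)) 1 = int m \<and> poly (S_cf (neg_cf_digits m n)) 1 = int n"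
  using assms
proof (induction n arbitrary: m rule: less_induct)
  case (less n)
  show ?case
  proof (cases "n = 0")
    case True
    then show ?thesis using less.prems by simp
  next
    case False
    then obtain c r where digits: "neg_cf_digits m n = c # neg_cf_digits n r"
      and r: "c * n = m + r" "r < n"
      using neg_cf_digits_ConsE[of n m] by blast
    have "coprime n r"
    proof (rule coprimeI)
      fix d assume d: "d dvd n" "d dvd r"
      then have "d dvd m" using r(1) by (metis dvd_add_left_iff dvd_mult)
      then show "is_unit d" using less.prems d(1) by (metis coprime_common_divisor)
    qed
    then show ?thesis
      using less.IH[OF r(2), of n] arg_cong[OF r(1), of int]
      by (simp add: digits poly_q_int poly_monom)
  qed
qed

section \<open>Degree and positivity\<close>

lemma poly_R_cf_0:
  assumes "\<forall>c \<in> set cs. 2 \<le> c"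
  shows "poly (R_cf cs) 0 = 1"
  using assms by (induction cs) (auto simp: poly_q_int poly_monom power_0_left)

lemma coeff_q_int: "coeff (q_int c) i = (if i < c then 1 else 0)"
  by (simp add: q_int_eq_sum coeff_sum)

lemma degree_q_int: "degree (q_int c) = c - 1"
proof (cases c)
  case (Suc k)
  then show ?thesis by (intro antisym degree_le le_degree) (auto simp: coeff_q_int)
qed (simp add: q_int_eq_sum)

lemma degree_q_int_mult_diff:
  assumes c_pos: "0 < c" and R_monic: "lead_coeff R = 1"
    and S_degree: "\<And>i. degree R \<le> i \<Longrightarrow> coeff S i = 0"
  defines "T \<equiv> q_int c * R - monom 1 (c - 1) * S"
  shows "degree T = c - 1 + degree R" "lead_coeff T = 1"
proof -
  have q_monic: "lead_coeff (q_int c) = 1" using c_pos by (simp add: degree_q_int coeff_q_int)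
  have "q_int c \<noteq> 0" "R \<noteq> 0" using q_monic R_monic by force+
  then have degree: "degree (q_int c * R) = c - 1 + degree R"
    by (simp add: degree_mult_eq degree_q_int)
  have coeff: "coeff T i = coeff (q_int c * R) i" if "c - 1 + degree R \<le> i" for i
    using that S_degree[of "i - (c - 1)"] by (simp add: T_def coeff_monom_mult)
  have top: "coeff T (c - 1 + degree R) = 1"
    using coeff[OF order_refl] lead_coeff_mult[of "q_int c" R]
    unfolding degree q_monic R_monic by simp
  show "degree T = c - 1 + degree R"
    using coeff degree top by (intro antisym degree_le le_degree) (auto simp: coeff_eq_0)
  with top show "lead_coeff T = 1" by simp
qed

lemma lead_coeff_R_cf:
  assumes "\<forall>c \<in> set cs. 2 \<le> c"
  shows "lead_coeff (R_cf cs) = 1 \<and> (\<forall>i \<ge> degree (R_cf cs). coeff (S_cf cs) i = 0)"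
  using assms
proof (induction cs)
  case (Cons c cs)
  then have "2 \<le> c" and IH: "lead_coeff (R_cf cs) = 1"
    "\<And>i. degree (R_cf cs) \<le> i \<Longrightarrow> coeff (S_cf cs) i = 0" by auto
  with degree_q_int_mult_diff[of c, OF _ IH] show ?case by (simp add: coeff_eq_0)
qed simp

lemma degree_R_cf_Cons:
  assumes "\<forall>c \<in> set (c # cs). 2 \<le> c"
  shows "degree (R_cf (c # cs)) = c - 1 + degree (R_cf cs)"
  using assms lead_coeff_R_cf[of cs] degree_q_int_mult_diff(1)[of c "R_cf cs" "S_cf cs"] by simp

lemma degree_R_cf_less:
  assumes "\<forall>c \<in> set cs. 2 \<le> c"
  shows "int (degree (R_cf cs)) < poly (R_cf cs) 1 \<and> poly (S_cf cs) 1 < poly (R_cf cs) 1"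
  using assms
proof (induction cs)
  case (Cons c cs)
  define d r s where "d = int (degree (R_cf cs))" and "r = poly (R_cf cs) 1"
    and "s = poly (S_cf cs) 1"
  have IH: "d < r" "s < r" and c_ge_2: "2 \<le> c" using Cons by (auto simp: d_def r_def s_def)
  have "0 \<le> d" by (simp add: d_def)
  have "int (c - 1) + d \<le> int (c - 1) * r"
  proof -
    have "0 \<le> (int (c - 1) - 1) * (r - 1)" using IH c_ge_2 \<open>0 \<le> d\<close> by simp
    then show ?thesis using IH by (simp add: algebra_simps)
  qed
  also have "\<dots> < int c * r - s" using IH c_ge_2 by (simp add: of_nat_diff algebra_simps)
  finally have "int (c - 1) + d < int c * r - s" .
  moreover have "1 * r \<le> int (c - 1) * r" using IH c_ge_2 \<open>0 \<le> d\<close> by (intro mult_right_mono) auto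
  then have "r < int c * r - s" using IH c_ge_2 by (simp add: of_nat_diff algebra_simps)
  moreover have "poly (R_cf (c # cs)) 1 = int c * r - s"
    by (simp add: poly_q_int poly_monom r_def s_def)
  ultimately show ?case
    using degree_R_cf_Cons[OF Cons.prems] by (simp add: d_def r_def)
qed simp

lemma ipoly_q_int: "ipoly (q_int c) z = (\<Sum>i<c. z ^ i)"
  unfolding q_int_eq_sum by (induction c) simp_all

lemma ipoly_RS_cf_nonneg:
  fixes x :: "'a::linordered_idom"
  assumes "\<forall>c \<in> set cs. 2 \<le> c" "0 \<le> x"
  shows "0 \<le> ipoly (S_cf cs) x \<and> ipoly (S_cf cs) x \<le> ipoly (R_cf cs) x \<and> 1 \<le> ipoly (R_cf cs) x"
  using assms(1)
proof (induction cs)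
  case (Cons c cs)
  define R S where "R = ipoly (R_cf cs) x" and "S = ipoly (S_cf cs) x"
  have IH: "0 \<le> S" "S \<le> R" "1 \<le> R" using Cons by (auto simp: R_def S_def)
  obtain k where c_eq: "c = Suc (Suc k)"
    using Cons.prems by (auto dest!: le_Suc_ex)
  have "ipoly (R_cf (c # cs)) x - R = x * (\<Sum>i<k. x ^ i) * R + x ^ Suc k * (R - S)"
    by (simp add: c_eq ipoly_q_int sum.lessThan_Suc_shift[of _ "Suc k"] sum_distrib_left R_def S_def
        algebra_simps del: sum.lessThan_Suc) (simp add: algebra_simps)
  also have "\<dots> \<ge> 0"
    using IH assms(2) by (intro add_nonneg_nonneg mult_nonneg_nonneg sum_nonneg) auto
  finally show ?case using IH by (simp add: R_def)
qed simp

lemma power_degree_le_ipoly_R_cf: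
  fixes x :: "'a::linordered_idom"
  assumes "\<forall>c \<in> set cs. 2 \<le> c" "1 \<le> x"
  shows "x * ipoly (S_cf cs) x \<le> ipoly (R_cf cs) x \<and> x ^ degree (R_cf cs) \<le> ipoly (R_cf cs) x"
  using assms(1)
proof (induction cs)
  case (Cons c cs)
  define R S where "R = ipoly (R_cf cs) x" and "S = ipoly (S_cf cs) x"
  have IH: "x * S \<le> R" "x ^ degree (R_cf cs) \<le> R" and "1 \<le> R"
    using Cons ipoly_RS_cf_nonneg[of cs x] assms(2) by (auto simp: R_def S_def)
  obtain k where c_eq: "c = Suc (Suc k)"
    using Cons.prems by (auto dest!: le_Suc_ex)
  have "ipoly (R_cf (c # cs)) x - x ^ Suc k * R = (\<Sum>i<k. x ^ i) * R + x ^ k * (R - x * S)"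
    by (simp add: c_eq ipoly_q_int R_def S_def algebra_simps)
  also have "\<dots> \<ge> 0"
    using IH assms(2) \<open>1 \<le> R\<close> by (intro add_nonneg_nonneg mult_nonneg_nonneg sum_nonneg) auto
  finally have R_power_le: "x ^ Suc k * R \<le> ipoly (R_cf (c # cs)) x" by simp
  have "x * R \<le> x ^ Suc k * R"
    using assms(2) \<open>1 \<le> R\<close> power_increasing[of 1 "Suc k" x] by (intro mult_right_mono) auto
  moreover have "x ^ Suc k * x ^ degree (R_cf cs) \<le> x ^ Suc k * R"
    using IH(2) assms(2) by (intro mult_left_mono) auto
  moreover have "x ^ degree (R_cf (c # cs)) = x ^ Suc k * x ^ degree (R_cf cs)"
    using degree_R_cf_Cons[OF Cons.prems] by (simp add: c_eq power_add mult_ac)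
  ultimately show ?case using R_power_le unfolding R_def RS_cf_Cons(2) by linarith
qed simp

section \<open>Values on the unit circle\<close>

lemma ipoly_RS_cf_invariant:
  fixes z :: "'a::comm_ring_1"
  assumes base: "P 1 0"
    and shear: "\<And>x y. P x y \<Longrightarrow> P (z * x + y) y"
    and rotate: "\<And>x y. P x y \<Longrightarrow> P (x - y) x"
    and cs: "\<forall>c \<in> set cs. 0 < c"
  shows "P (ipoly (R_cf cs) z) (ipoly (S_cf cs) z)"
  using cs
proof (induction cs)
  case Nil
  then show ?case using base by simp
next
  case (Cons c cs)
  define x y where "x = ipoly (R_cf cs) z" and "y = ipoly (S_cf cs) z"
  have "P ((\<Sum>i<Suc k. z ^ i) * x - z ^ k * y) x" for k
  proof (induction k)
    case 0
    then show ?case using rotate[of x y] Cons by (simp add: x_def y_def)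
  next
    case (Suc k)
    have "z * ((\<Sum>i<Suc k. z ^ i) * x - z ^ k * y) + x
        = (\<Sum>i<Suc (Suc k). z ^ i) * x - z ^ Suc k * y"
      unfolding sum.lessThan_Suc_shift[of _ "Suc k"]
      by (simp add: sum_distrib_left algebra_simps del: sum.lessThan_Suc)
    then show ?case using shear[OF Suc] by simp
  qed
  from this[of "c - 1"] show ?case
    using Cons.prems by (simp add: x_def y_def ipoly_q_int)
qed

lemma cmod_add_power2: "(cmod (u + v))\<^sup>2 = (cmod u)\<^sup>2 + (cmod v)\<^sup>2 + 2 * Re (u * cnj v)"
  unfolding cmod_power2 by (simp add: power2_eq_square algebra_simps)

lemma cmod_diff_power2: "(cmod (u - v))\<^sup>2 = (cmod u)\<^sup>2 + (cmod v)\<^sup>2 - 2 * Re (u * cnj v)"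
  using cmod_add_power2[of u "- v"] by simp

lemma Re_mult_self_cnj: "Re (b * (x * cnj x)) = Re b * (cmod x)\<^sup>2"
  unfolding complex_norm_square[symmetric] by simp

text \<open>Invariant under the two linear maps that generate the matrices \<open>M\<^sub>q(c)\<close> at \<open>q = z\<close>, because
  \<open>Re (z / (1 - z)) = - 1 / 2\<close> on the unit circle; definite for \<open>|1 - z| > 1\<close>.\<close>

definition hermitian_form :: "complex \<Rightarrow> complex \<Rightarrow> complex \<Rightarrow> real" where
  "hermitian_form z x y = (cmod x)\<^sup>2 + (cmod y)\<^sup>2 + 2 * Re (z / (1 - z) * x * cnj y)"

lemma Re_div_1_minus:
  assumes "cmod z = 1" "z \<noteq> 1"
  shows "Re (z / (1 - z)) = - 1 / 2"
proof -
  define b where "b = z / (1 - z)"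
  have "1 + b = 1 / (1 - z)" using assms(2) by (simp add: b_def field_simps)
  then have "cmod (1 + b) = cmod b" using assms(1) by (simp add: b_def norm_divide)
  then have "Re b = - 1 / 2" using cmod_add_power2[of 1 b] by simp
  then show ?thesis by (simp add: b_def)
qed

lemma hermitian_form_shear:
  assumes "cmod z = 1" "z \<noteq> 1"
  shows "hermitian_form z (z * x + y) y = hermitian_form z x y"
proof -
  define b where "b = z / (1 - z)"
  have b_times_z: "b * z = b - z" using assms(2) by (simp add: b_def field_simps)
  have "b * (z * x + y) * cnj y = (b * z) * x * cnj y + b * (y * cnj y)"
    by (simp add: algebra_simps)
  also have "(b * z) * x * cnj y = b * x * cnj y - z * x * cnj y"
    unfolding b_times_z by (simp add: left_diff_distrib)
  finally have "Re (b * (z * x + y) * cnj y)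
      = Re (b * x * cnj y) - Re (z * x * cnj y) + Re (b * (y * cnj y))"
    by simp
  also have "Re (b * (y * cnj y)) = - (cmod y)\<^sup>2 / 2"
    using Re_div_1_minus[OF assms] unfolding Re_mult_self_cnj b_def by simp
  finally have "Re (b * (z * x + y) * cnj y)
      = Re (b * x * cnj y) - Re (z * x * cnj y) - (cmod y)\<^sup>2 / 2"
    by simp
  then show ?thesis
    using assms(1) unfolding hermitian_form_def b_def[symmetric]
    by (simp add: cmod_add_power2 norm_mult)
qed

lemma hermitian_form_rotate:
  assumes "cmod z = 1" "z \<noteq> 1"
  shows "hermitian_form z (x - y) x = hermitian_form z x y"
proof -
  define b where "b = z / (1 - z)"
  have Re_b: "Re b = - 1 / 2" using Re_div_1_minus[OF assms] by (simp add: b_def)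
  then have cnj_b: "cnj b = - 1 - b" by (simp add: complex_eq_iff)
  have "Re (b * (x - y) * cnj x) = Re (b * (x * cnj x)) - Re (b * (y * cnj x))"
    by (simp add: algebra_simps)
  also have "Re (b * (y * cnj x)) = Re (cnj b * (x * cnj y))"
    by (simp add: algebra_simps)
  also have "Re (b * (x * cnj x)) = - (cmod x)\<^sup>2 / 2"
    unfolding Re_mult_self_cnj Re_b by simp
  also have "Re (cnj b * (x * cnj y)) = - Re (x * cnj y) - Re (b * x * cnj y)"
    unfolding cnj_b by (simp add: algebra_simps)
  finally show ?thesis
    unfolding hermitian_form_def b_def[symmetric] by (simp add: cmod_diff_power2)
qed

lemma hermitian_form_ge:
  assumes "cmod z = 1" "z \<noteq> 1"
  shows "(1 - 1 / (cmod (1 - z))\<^sup>2) * (cmod x)\<^sup>2 \<le> hermitian_form z x y"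
proof -
  define b where "b = z / (1 - z)"
  have "0 \<le> (cmod (b * x + y))\<^sup>2" by simp
  also have "\<dots> = hermitian_form z x y - (1 - (cmod b)\<^sup>2) * (cmod x)\<^sup>2"
    unfolding hermitian_form_def b_def[symmetric] cmod_add_power2
    by (simp add: norm_mult power_mult_distrib algebra_simps)
  also have "cmod b = 1 / cmod (1 - z)" using assms(1) by (simp add: b_def norm_divide)
  finally show ?thesis by (simp add: power_divide)
qed

lemma hermitian_form_RS_cf:
  assumes "cmod z = 1" "z \<noteq> 1" "\<forall>c \<in> set cs. 0 < c"
  shows "hermitian_form z (ipoly (R_cf cs) z) (ipoly (S_cf cs) z) = 1"
  by (rule ipoly_RS_cf_invariant[where P = "\<lambda>x y. hermitian_form z x y = 1", OF _ _ _ assms(3)])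
    (simp_all add: hermitian_form_shear[OF assms(1,2)] hermitian_form_rotate[OF assms(1,2)],
      simp add: hermitian_form_def)

text \<open>If \<open>2 Re z = - t\<close>, then \<open>z\<close> is a root of \<open>X\<^sup>2 + t X + 1\<close>, which takes the value \<open>t + 2\<close> at 1.\<close>

lemma ipoly_eq_int_combination:
  fixes z :: complex and t :: int
  assumes "cmod z = 1" "2 * Re z = - of_int t"
  shows "\<exists>x y m. ipoly f z = of_int x + of_int y * z \<and> poly f 1 = x + y + (t + 2) * m"
proof (induction f)
  case 0
  show ?case by (intro exI[of _ 0]) simp
next
  case (pCons a f)
  then obtain x y m where IH: "ipoly f z = of_int x + of_int y * z"
    "poly f 1 = x + y + (t + 2) * m"
    by blast
  have "z + cnj z = - of_int t" using assms(2) by (simp add: complex_eq_iff)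
  moreover have "z * cnj z = 1" using assms(1) by (simp flip: complex_norm_square)
  ultimately have z_squared: "z * z = - of_int t * z - 1"
    by (metis add_diff_cancel_right' distrib_left mult.commute)
  have "z * (of_int y * z) = of_int y * (z * z)" by simp
  also have "\<dots> = - of_int (t * y) * z - of_int y"
    unfolding z_squared by (simp add: algebra_simps)
  finally have z_times_yz: "z * (of_int y * z) = - of_int (t * y) * z - of_int y" .
  have "ipoly (pCons a f) z = of_int (a - y) + of_int (x - t * y) * z"
    unfolding ipoly_pCons IH(1) distrib_left z_times_yz by (simp add: algebra_simps)
  moreover have "poly (pCons a f) 1 = (a - y) + (x - t * y) + (t + 2) * (y + m)"
    by (simp add: IH(2) algebra_simps)
  ultimately show ?case by blast
qed

lemma cmod_int_combination_power2:
  assumes "cmod z = 1" "2 * Re z = - of_int t"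
  shows "(cmod (of_int x + of_int y * z))\<^sup>2 = of_int (x\<^sup>2 - t * x * y + y\<^sup>2)"
proof -
  have "2 * Re (of_int x * cnj (of_int y * z)) = of_int x * of_int y * (2 * Re z)"
    by simp
  then show ?thesis
    using assms by (simp add: cmod_add_power2 norm_mult power_mult_distrib)
qed

lemma cmod_ipoly_power2_congE:
  assumes "cmod z = 1" "2 * Re z = - of_int t"
  obtains n :: int where "(cmod (ipoly f z))\<^sup>2 = of_int n" "t + 2 dvd (poly f 1)\<^sup>2 - n"
proof -
  obtain x y m where xy: "ipoly f z = of_int x + of_int y * z"
    and m: "poly f 1 = x + y + (t + 2) * m"
    using ipoly_eq_int_combination[OF assms] by blast
  have "(poly f 1)\<^sup>2 - (x\<^sup>2 - t * x * y + y\<^sup>2)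
      = (t + 2) * (x * y + 2 * (x + y) * m + (t + 2) * m\<^sup>2)"
    unfolding m by (simp add: power2_eq_square algebra_simps)
  then show thesis
    using that[of "x\<^sup>2 - t * x * y + y\<^sup>2"] cmod_int_combination_power2[OF assms, of x y] xy
    by (metis dvd_triv_left)
qed

lemma cmod_ipoly_dvd_eq_1:
  assumes "cmod z = 1" "2 * Re z = - of_int t" "f dvd g" "cmod (ipoly g z) = 1"
  shows "cmod (ipoly f z) = 1"
proof -
  obtain h where h: "g = f * h" using assms(3) by blast
  obtain m n where mn: "(cmod (ipoly f z))\<^sup>2 = of_int m" "(cmod (ipoly h z))\<^sup>2 = of_int n"
    using cmod_ipoly_power2_congE[OF assms(1,2)] by metis
  have "(of_int (m * n) :: real) = (cmod (ipoly g z))\<^sup>2"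
    by (simp add: h norm_mult power_mult_distrib mn)
  then have "m * n = 1" using assms(4) by (simp flip: of_int_mult)
  moreover have "0 \<le> m" using mn(1) by (metis of_int_0_le_iff zero_le_power2)
  ultimately have "m = 1" by (auto simp: zmult_eq_1_iff)
  then show ?thesis using mn(1) abs_square_eq_1[of "cmod (ipoly f z)"] by simp
qed

lemma cmod_R_cf_eq_1:
  assumes "cmod z = 1" "2 * Re z = - of_int t" "0 \<le> t"
    and cs: "\<forall>c \<in> set cs. 0 < c" and not_dvd: "\<not> t + 2 dvd (poly (R_cf cs) 1)\<^sup>2"
  shows "cmod (ipoly (R_cf cs) z) = 1"
proof -
  obtain n where n: "(cmod (ipoly (R_cf cs) z))\<^sup>2 = of_int n"
    and dvd: "t + 2 dvd (poly (R_cf cs) 1)\<^sup>2 - n"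
    using cmod_ipoly_power2_congE[OF assms(1,2)] by metis
  have "z \<noteq> 1" using assms(2,3) by auto
  have "(cmod (1 - z))\<^sup>2 = of_int (t + 2)" using assms(1,2) by (simp add: cmod_diff_power2)
  then have "(1 - 1 / of_int (t + 2)) * of_int n \<le> (1 :: real)"
    using hermitian_form_ge[OF assms(1) \<open>z \<noteq> 1\<close>] hermitian_form_RS_cf[OF assms(1) \<open>z \<noteq> 1\<close> cs] n
    by metis
  then have "of_int ((t + 1) * n) \<le> (of_int (t + 2) :: real)"
    using assms(3) by (simp add: field_simps)
  then have bound: "(t + 1) * (n - 1) \<le> 1" unfolding of_int_le_iff by (simp add: algebra_simps)
  have "0 \<le> n" using n by (metis of_int_0_le_iff zero_le_power2)
  moreover have "n \<noteq> 0" using dvd not_dvd by auto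
  moreover have "\<not> 2 \<le> n"
  proof
    assume "2 \<le> n"
    then have "(t + 1) * 1 \<le> (t + 1) * (n - 1)" using assms(3) by (intro mult_left_mono) auto
    then have "(t + 1) * 1 \<le> 1" using bound by (rule order_trans)
    then have "t = 0" using assms(3) by simp
    then have "n = 2" using bound \<open>2 \<le> n\<close> by simp
    then show False using dvd not_dvd \<open>t = 0\<close> by simp
  qed
  ultimately have "n = 1" by linarith
  then show ?thesis using n abs_square_eq_1[of "cmod (ipoly (R_cf cs) z)"] by simp
qed

section \<open>Polynomials of small degree with unit values\<close>

definition \<omega> :: complex where
  "\<omega> = Complex (- 1 / 2) (sqrt 3 / 2)"

lemma \<omega>_simps [simp]: "Re \<omega> = - 1 / 2" "Im \<omega> = sqrt 3 / 2" "cmod \<omega> = 1"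
  by (simp_all add: \<omega>_def cmod_def power2_eq_square)

lemma \<omega>_mult_\<omega>_mult: "\<omega> * (\<omega> * z) = - z - \<omega> * z"
proof -
  have "\<omega> * \<omega> = - 1 - \<omega>" by (simp add: complex_eq_iff)
  then have "\<omega> * \<omega> * z = (- 1 - \<omega>) * z" by simp
  then show ?thesis by (simp add: algebra_simps)
qed

lemma int_combination_eqD:
  assumes "Im z \<noteq> 0" "of_int x + of_int y * z = of_int u + of_int v * z"
  shows "x = u" "y = v"
  using assms by (auto simp: complex_eq_iff)

definition unit_valued :: "int poly \<Rightarrow> bool" where
  "unit_valued f \<longleftrightarrow> (\<forall>z \<in> {- 1, \<i>, \<omega>}. cmod (ipoly f z) = 1)"

lemma unit_valued_dvd:
  assumes "unit_valued g" "f dvd g"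
  shows "unit_valued f"
  using assms cmod_ipoly_dvd_eq_1[of "- 1" 2 f g] cmod_ipoly_dvd_eq_1[of \<i> 0 f g]
    cmod_ipoly_dvd_eq_1[of \<omega> 1 f g]
  by (simp add: unit_valued_def)

lemma unit_valued_R_cf:
  assumes "\<forall>c \<in> set cs. 0 < c" "poly (R_cf cs) 1 = int p" "prime p" "3 < p"
  shows "unit_valued (R_cf cs)"
proof -
  have "\<not> q dvd p\<^sup>2" if "prime q" "q \<le> 3" for q
    using that assms(3,4) by (metis linorder_not_le prime_dvd_power primes_dvd_imp_eq)
  from this[of 2] this[of 3] have "\<not> 2 dvd p\<^sup>2" "\<not> 3 dvd p\<^sup>2" by simp_all
  moreover from this(1) have "\<not> 4 dvd p\<^sup>2" by (metis dvd_trans even_numeral)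
  ultimately have "\<not> 2 dvd (int p)\<^sup>2" "\<not> 3 dvd (int p)\<^sup>2" "\<not> 4 dvd (int p)\<^sup>2"
    by (metis int_dvd_int_iff of_nat_numeral of_nat_power)+
  then show ?thesis
    using assms(1,2) cmod_R_cf_eq_1[of \<i> 0 cs] cmod_R_cf_eq_1[of \<omega> 1 cs]
      cmod_R_cf_eq_1[of "- 1" 2 cs]
    by (simp add: unit_valued_def)
qed

definition unit_combinations :: "int \<Rightarrow> (int \<times> int) list" where
  "unit_combinations t =
    filter (\<lambda>(x, y). x\<^sup>2 - t * x * y + y\<^sup>2 = 1) (List.product [-1, 0, 1] [-1, 0, 1])"

lemma in_unit_combinations_iff:
  assumes "\<bar>t\<bar> \<le> 1"
  shows "(x, y) \<in> set (unit_combinations t) \<longleftrightarrow> x\<^sup>2 - t * x * y + y\<^sup>2 = 1"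
proof -
  have bound: "x \<in> {-1, 0, 1}" if norm: "x\<^sup>2 - t * x * y + y\<^sup>2 = 1" for x y
  proof -
    have "t\<^sup>2 \<le> 1" using assms abs_le_square_iff[of t 1] by simp
    then have "3 * x\<^sup>2 \<le> (4 - t\<^sup>2) * x\<^sup>2" by (intro mult_right_mono) auto
    also have "\<dots> \<le> (2 * y - t * x)\<^sup>2 + (4 - t\<^sup>2) * x\<^sup>2" by simp
    also have "\<dots> = 4 * (x\<^sup>2 - t * x * y + y\<^sup>2)" by (simp add: power2_eq_square algebra_simps)
    finally have "x\<^sup>2 \<le> 1\<^sup>2" using norm by simp
    then have "\<bar>x\<bar> \<le> 1" using abs_le_square_iff[of x 1] by simp
    then show ?thesis by auto
  qed
  show ?thesis
    using bound[of x y] bound[of y x] by (auto simp: unit_combinations_def algebra_simps)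
qed

lemma ipoly_eq_unit_combination:
  assumes z: "cmod z = 1" "2 * Re z = - of_int t" and t: "\<bar>t\<bar> \<le> 1" and f: "cmod (ipoly f z) = 1"
  shows "\<exists>x y. ipoly f z = of_int x + of_int y * z \<and> (x, y) \<in> set (unit_combinations t)"
proof -
  obtain x y where xy: "ipoly f z = of_int x + of_int y * z"
    using ipoly_eq_int_combination[OF z] by blast
  then have "of_int (x\<^sup>2 - t * x * y + y\<^sup>2) = (1::real)"
    using f cmod_int_combination_power2[OF z, of x y] by simp
  then show ?thesis using xy in_unit_combinations_iff[OF t] unfolding of_int_eq_1_iff by blast
qed

text \<open>The coefficients of the polynomial \<open>f\<close> of degree at most 6 with \<open>f(0) = 1\<close>, \<open>f(- 1) = e\<close>,
  \<open>f(\<i>) = x + y \<i>\<close>, \<open>f(\<omega>) = u + v \<omega>\<close> and coefficient \<open>c6\<close> at degree 6, found by solving the linear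
  system.\<close>

definition interpolant :: "int \<Rightarrow> int \<Rightarrow> int \<Rightarrow> int \<Rightarrow> int \<Rightarrow> int \<Rightarrow> int list" where
  "interpolant e x y u v c6 =
    (let h = (x + y - e) div 2;
         c5 = 1 + 2 * c6 + h - y - u;
         c2 = v + 1 - x - h - 2 * c6 + 2 * c5;
         c1 = c2 + c6 - c5 + h;
         c3 = c1 + c5 - y;
         c4 = x - 1 + c2 + c6
     in strip_while ((=) 0) [1, c1, c2, c3, c4, c5, c6])"

lemma coeffs_eq_interpolant:
  assumes degree: "degree f \<le> 6" and const: "coeff f 0 = 1"
    and at_i: "ipoly f \<i> = of_int x + of_int y * \<i>"
    and at_\<omega>: "ipoly f \<omega> = of_int u + of_int v * \<omega>"
  shows "coeffs f = interpolant (poly f (- 1)) x y u v (coeff f 6)"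
proof -
  define cs where "cs = map (coeff f) [0..<7]"
  obtain c1 c2 c3 c4 c5 c6 where cs: "cs = [1, c1, c2, c3, c4, c5, c6]" and c6: "coeff f 6 = c6"
    using const by (simp add: cs_def upt_rec numeral_eq_Suc)
  have f: "f = Poly cs"
    using degree by (intro poly_eqI) (auto simp: coeff_Poly_eq nth_default_def cs_def coeff_eq_0)
  have "of_int x + of_int y * \<i> = of_int (1 - c2 + c4 - c6) + of_int (c1 - c3 + c5) * \<i>"
    unfolding at_i[symmetric] by (simp add: f cs complex_eq_iff)
  from int_combination_eqD[OF _ this] have xy: "x = 1 - c2 + c4 - c6" "y = c1 - c3 + c5"
    by simp_all
  have "of_int u + of_int v * \<omega> = of_int (1 - c2 + c3 - c5 + c6) + of_int (c1 - c2 + c4 - c5) * \<omega>"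
    unfolding at_\<omega>[symmetric] by (simp add: f cs \<omega>_mult_\<omega>_mult algebra_simps)
  from int_combination_eqD[OF _ this] have uv: "u = 1 - c2 + c3 - c5 + c6" "v = c1 - c2 + c4 - c5"
    by simp_all
  have "x + y - poly f (- 1) = 2 * (c1 - c2 + c5 - c6)" by (simp add: f cs xy)
  then have "(x + y - poly f (- 1)) div 2 = c1 - c2 + c5 - c6" by simp
  then have "interpolant (poly f (- 1)) x y u v c6 = strip_while ((=) 0) cs"
    by (simp add: interpolant_def Let_def cs xy uv)
  then show ?thesis unfolding c6 using arg_cong[OF f, of coeffs] by simp
qed

definition small_unit_valued_coeffs :: "int list list" where
  "small_unit_valued_coeffs = filter (\<lambda>cs. last cs = 1 \<and> 1 < length cs)
    [interpolant e x y u v c6.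
      e \<leftarrow> [1, -1], (x, y) \<leftarrow> unit_combinations 0, (u, v) \<leftarrow> unit_combinations 1, c6 \<leftarrow> [0, 1]]"

lemma coeffs_in_small_unit_valued_coeffs:
  assumes unit: "unit_valued f" and lc: "lead_coeff f = 1" and const: "coeff f 0 = 1"
    and degree: "1 \<le> degree f" "degree f \<le> 6"
  shows "coeffs f \<in> set small_unit_valued_coeffs"
proof -
  have "\<bar>poly f (- 1)\<bar> = 1"
    using unit ipoly_of_int[of f "- 1", where 'a = complex]
    by (simp add: unit_valued_def flip: of_int_abs)
  then have at_minus_1: "poly f (- 1) \<in> set [1, - 1]" by auto
  obtain x y where at_i: "ipoly f \<i> = of_int x + of_int y * \<i>" "(x, y) \<in> set (unit_combinations 0)"
    using unit ipoly_eq_unit_combination[of \<i> 0 f] by (auto simp: unit_valued_def)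
  obtain u v where at_\<omega>: "ipoly f \<omega> = of_int u + of_int v * \<omega>" "(u, v) \<in> set (unit_combinations 1)"
    using unit ipoly_eq_unit_combination[of \<omega> 1 f] by (auto simp: unit_valued_def)
  have top: "coeff f 6 \<in> set [0, 1]"
    using lc degree(2) by (cases "degree f = 6") (auto simp: coeff_eq_0)
  have "f \<noteq> 0" using const by auto
  then have "last (coeffs f) = 1" "1 < length (coeffs f)"
    using lc degree by (simp_all add: last_coeffs_eq_coeff_degree length_coeffs_degree)
  with at_minus_1 at_i(2) at_\<omega>(2) top show ?thesis
    unfolding coeffs_eq_interpolant[OF degree(2) const at_i(1) at_\<omega>(1)] small_unit_valued_coeffs_def
    by (simp only: set_filter set_concat set_map) force
qed

fun RS_cf_at_2 :: "nat list \<Rightarrow> int \<times> int" where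
  "RS_cf_at_2 [] = (1, 0)"
| "RS_cf_at_2 (c # cs) = (let (r, s) = RS_cf_at_2 cs in ((2 ^ c - 1) * r - 2 ^ (c - 1) * s, r))"

lemma RS_cf_at_2_eq: "RS_cf_at_2 cs = (poly (R_cf cs) 2, poly (S_cf cs) 2)"
proof (induction cs)
  case (Cons c cs)
  have "poly (q_int c) 2 = 2 ^ c - 1"
    using power_diff_1_eq[of "2::int" c] by (simp add: poly_q_int)
  then show ?case by (simp add: Cons poly_monom)
qed simp

lemma small_unit_valued_coeffs_values:
  "\<forall>cs \<in> set small_unit_valued_coeffs. let m = horner_sum id 1 cs; v = horner_sum id 2 cs in
     m \<noteq> 1 \<and> (\<forall>r \<in> set [0..<nat m]. let s = fst (RS_cf_at_2 (neg_cf_digits (nat m) r)) in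
       2 ^ (length cs + 6) \<le> s \<longrightarrow> \<not> v dvd s)"
  by code_simp

lemma
  assumes "unit_valued f" "lead_coeff f = 1" "coeff f 0 = 1" "1 \<le> degree f" "degree f \<le> 6"
  shows poly_1_neq_1_if_small_unit_valued: "poly f 1 \<noteq> 1"
    and poly_2_not_dvd_if_small_unit_valued: "\<lbrakk>poly f 1 = int m; r < m;
      2 ^ (degree f + 7) \<le> poly (R_cf (neg_cf_digits m r)) 2\<rbrakk>
      \<Longrightarrow> \<not> poly f 2 dvd poly (R_cf (neg_cf_digits m r)) 2"
proof -
  have "f \<noteq> 0" using assms(3) by auto
  then have length: "length (coeffs f) + 6 = degree f + 7" by (simp add: length_coeffs_degree)
  note check = bspec[OF small_unit_valued_coeffs_values
        coeffs_in_small_unit_valued_coeffs[OF assms],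
      unfolded Let_def length RS_cf_at_2_eq, folded poly_def]
  show "poly f 1 \<noteq> 1" using check by blast
  show "\<not> poly f 2 dvd poly (R_cf (neg_cf_digits m r)) 2"
    if "poly f 1 = int m" "r < m" "2 ^ (degree f + 7) \<le> poly (R_cf (neg_cf_digits m r)) 2"
    using check that by simp
qed

section \<open>Factorizations of \<open>\<R>\<close>\<close>

lemma
  assumes cs: "\<forall>c \<in> set cs. 2 \<le> c" and fh: "R_cf cs = f * h"
    and lc: "lead_coeff f = 1" "lead_coeff h = 1"
  shows coeff_0_monic_factor_R_cf: "coeff f 0 = 1"
    and poly_1_monic_factor_R_cf_pos: "0 < poly f 1"
proof -
  have pos: "0 < poly g n" if "g dvd R_cf cs" "lead_coeff g = 1" "0 \<le> n" for g n
  proof (rule poly_pos_if_monic_no_nonneg_root[OF that(2) _ that(3)])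
    fix x :: real
    assume "0 \<le> x"
    then have "ipoly (R_cf cs) x \<noteq> 0" using ipoly_RS_cf_nonneg[OF cs, of x] by auto
    then show "ipoly g x \<noteq> 0" using that(1) by (auto elim!: dvdE)
  qed
  have "poly f 0 * poly h 0 = 1" using poly_R_cf_0[OF cs] fh by simp
  moreover have "0 < poly f 0" "0 < poly h 0" using pos lc fh by simp_all
  ultimately show "coeff f 0 = 1" by (auto simp: zmult_eq_1_iff poly_0_coeff_0)
  show "0 < poly f 1" using pos lc fh by simp
qed

lemma R_cf_at_1_gt_3_if_factors:
  assumes cs: "\<forall>c \<in> set cs. 2 \<le> c" and fh: "R_cf cs = f * h"
    and lc: "lead_coeff f = 1" "lead_coeff h = 1"
    and degree: "1 \<le> degree f" "1 \<le> degree h"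
  shows "3 < poly (R_cf cs) 1"
proof -
  have "degree (R_cf cs) = degree f + degree h"
    unfolding fh using lc by (intro degree_mult_eq) auto
  then have less: "int (degree f + degree h) < poly (R_cf cs) 1"
    using degree_R_cf_less[OF cs] by simp
  have linear: "poly g 1 = 2" if "lead_coeff g = 1" "coeff g 0 = 1" "degree g = 1"
    for g :: "int poly"
    using that by (simp add: poly_altdef)
  have "poly (R_cf cs) 1 \<noteq> 3"
  proof
    assume at_1: "poly (R_cf cs) 1 = 3"
    then have "degree f = 1" "degree h = 1" using less degree by linarith+
    moreover have "coeff f 0 = 1" "coeff h 0 = 1"
      using coeff_0_monic_factor_R_cf[OF cs, of f h] coeff_0_monic_factor_R_cf[OF cs, of h f] fh lc
      by (simp_all add: mult.commute)
    ultimately show False using linear lc at_1 fh by simp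
  qed
  then show ?thesis using less degree by linarith
qed

lemma degree_monic_factor_R_cf:
  assumes p: "prime p" "coprime p r" "r < p"
    and fh: "R_cf (neg_cf_digits p r) = f * h"
    and lc: "lead_coeff f = 1" "lead_coeff h = 1"
    and degree: "1 \<le> degree f" "1 \<le> degree h"
  shows "7 \<le> degree f"
proof (rule ccontr)
  define R where "R = R_cf (neg_cf_digits p r)"
  note cs = neg_cf_digits_ge_2[OF p(3)]
  have hf: "R_cf (neg_cf_digits p r) = h * f" using fh by simp
  note f = coeff_0_monic_factor_R_cf[OF cs fh lc] poly_1_monic_factor_R_cf_pos[OF cs fh lc]
    and h = coeff_0_monic_factor_R_cf[OF cs hf lc(2,1)]
      poly_1_monic_factor_R_cf_pos[OF cs hf lc(2,1)]
  have R_1: "poly R 1 = int p" using poly_RS_cf_neg_cf_digits_1[OF p(2)] by (simp add: R_def)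
  then have "3 < p" using R_cf_at_1_gt_3_if_factors[OF cs fh lc degree] by (simp add: R_def)
  then have "unit_valued R"
    using cs R_1 p(1) unfolding R_def by (intro unit_valued_R_cf) auto
  then have unit: "unit_valued f" "unit_valued h"
    using fh by (metis R_def unit_valued_dvd dvd_triv_left dvd_triv_right)+
  assume "\<not> 7 \<le> degree f"
  then have degree_f: "degree f \<le> 6" by simp
  have "poly f 1 * poly h 1 = int p" using R_1 fh by (simp add: R_def)
  moreover have "irreducible (int p)" using p(1) by (simp add: prime_elem_imp_irreducible)
  ultimately have "is_unit (poly f 1) \<or> is_unit (poly h 1)" by (metis irreducibleD)
  moreover have "poly f 1 \<noteq> 1"
    using poly_1_neq_1_if_small_unit_valued[OF unit(1) lc(1) f(1) degree(1) degree_f] .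
  ultimately have "poly h 1 = 1" using f(2) h(2) by auto
  then have "poly f 1 = int p" and "\<not> degree h \<le> 6"
    using \<open>poly f 1 * poly h 1 = int p\<close>
      poly_1_neq_1_if_small_unit_valued[OF unit(2) lc(2) h(1) degree(2)] by auto
  have "(2::int) ^ (degree f + 7) \<le> 2 ^ (degree f + degree h)"
    using \<open>\<not> degree h \<le> 6\<close> by (intro power_increasing) auto
  also have "degree f + degree h = degree R"
    unfolding R_def fh using lc by (intro degree_mult_eq[symmetric]) auto
  also have "2 ^ degree R \<le> poly R 2"
    using power_degree_le_ipoly_R_cf[OF cs, of "2::int"] ipoly_of_int[of _ 2, where 'a = int]
    by (simp add: R_def)
  finally have "\<not> poly f 2 dvd poly R 2"
    using poly_2_not_dvd_if_small_unit_valued[OF unit(1) lc(1) f(1) degree(1) degree_f]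
      \<open>poly f 1 = int p\<close> p(3) by (simp add: R_def)
  then show False by (simp add: R_def fh)
qed

theorem theorem7p10:
  fixes p :: nat and a :: int and S :: "rat poly"
  assumes "prime p"
    and "coprime a (int p)"
    and "S = map_poly rat_of_int (q_denom (rat_of_int a / rat_of_nat p))"
    and "reducible S"
  shows "\<forall>g. irreducible g \<and> g dvd S \<longrightarrow> 7 \<le> degree g"
proof (intro allI impI, elim conjE)
  fix g :: "rat poly"
  assume g: "irreducible g" "g dvd S"
  obtain h where h: "S = g * h" "h \<noteq> 0" "\<not> is_unit h"
    using reducible_cofactorE[OF assms(4) g] by blast
  have "0 < p" using assms(1) by (rule prime_gt_0_nat)
  obtain r where r: "r < p" "coprime p r"
    and S: "S = map_poly rat_of_int (R_cf (neg_cf_digits p r))"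
    using q_denom_eq_R_cf_coprime[OF \<open>0 < p\<close> assms(2)] assms(3) by metis
  have "lead_coeff (R_cf (neg_cf_digits p r)) = 1"
    using neg_cf_digits_ge_2[OF r(1)] lead_coeff_R_cf by blast
  then obtain G H where GH: "R_cf (neg_cf_digits p r) = G * H"
    "degree G = degree g" "degree H = degree h" "lead_coeff G = 1" "lead_coeff H = 1"
    using monic_gauss_factorization h(1) S by metis
  have "degree g \<noteq> 0" "degree h \<noteq> 0"
    using g(1) h by (auto simp: irreducible_def is_unit_iff_degree)
  then show "7 \<le> degree g"
    using degree_monic_factor_R_cf[OF assms(1) r(2,1) GH(1,4,5)] GH(2,3) by simp
qed

end
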